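(* Let $d\ge1$ and $k\ge0$, let $\{P_n\}$ be a monic $d$-OPS, and let $\{P_n^c\}$ be a generalized co-recursive sequence of $\{P_n\}$ at level $k$. Then the solution of the recurrence defining $\{P_n^c\}$ can be written as follows: there exist polynomials $A_1(x),\dots,A_d(x)$, not depending on $n$, such that $$P_n^c(x)=P_n(x)-\sum_{i=1}^{d}A_i(x)\,P_{n-k-i}^{(k+i)}(x),\qquad n\ge0,$$ and $P_n^c(x)=P_n(x)$ for $n\le k$.
   Context: A monic $d$-OPS is given by complex numbers $\beta_n$ ($n\ge0$) and $\gamma_n^s$ ($n\ge1$, $0\le s\le d-1$) with $\gamma_n^0\ne0$ for all $n\ge1$. For $r\ge0$ the associated sequence of order $r$ is defined by $P_n^{(r)}=0$ for $n<0$, $P_0^{(r)}=1$ and $$P_{n+1}^{(r)}(x)=(x-\beta_{n+r})P_n^{(r)}(x)-\sum_{\nu=0}^{d-1}\gamma_{n+r-\nu}^{d-1-\nu}P_{n-1-\nu}^{(r)}(x),\quad n\ge0,$$ where terms with $n-1-\nu<0$ are zero; $P_n=P_n^{(0)}$. A generalized co-recursive sequence at level $k$ is defined by $P_m^c=0$ for $m<0$, $P_m^c=P_m$ for $0\le m\le k$, $$P_m^c(x)=(x-\alpha_{m-1})P_{m-1}^c(x)-\sum_{\nu=0}^{d-1}\xi_{m-1-\nu}^{d-1-\nu}P_{m-2-\nu}^c(x),\quad k+1\le m\le k+d,$$ $$P_{m+d+1}^c(x)=(x-\beta_{m+d})P_{m+d}^c(x)-\sum_{\nu=0}^{d-1}\gamma_{m+d-\nu}^{d-1-\nu}P_{m+d-1-\nu}^c(x),\quad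 m\ge k,$$ where $\alpha_n=\beta_n+\mu_n$, $\xi_n^\nu=\gamma_n^\nu+\eta_n^\nu$ for $1\le\nu\le d-1$, and $\xi_n^0=\gamma_n^0$, with arbitrary complex numbers $\mu_n,\eta_n^\nu$; terms whose polynomial has negative index are zero. *)

theory Defs
  imports Complex_Main "HOL-Computational_Algebra.Polynomial"
begin

text \<open>
  Polynomial sequences are indexed by integers, so that the convention that polynomials
  of negative index vanish can be stated literally.  The recurrence coefficients
  \<open>\<beta> n\<close>, \<open>\<gamma> n s\<close> (lower index first, upper index second) are indexed by naturals.  The truncated
  differences occurring in the lower index of \<open>\<gamma>\<close> below truncate only in terms whose
  polynomial factor has negative index and hence is zero.
\<close>

function assoc_poly ::
  "nat \<Rightarrow> (nat \<Rightarrow> complex) \<Rightarrow> (nat \<Rightarrow> nat \<Rightarrow> complex) \<Rightarrow> nat \<Rightarrow> int \<Rightarrow> complex poly"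
where
  "assoc_poly d \<beta> \<gamma> r n =
    (if n < 0 then 0
     else if n = 0 then 1
     else [:- \<beta> (nat (n - 1) + r), 1:] * assoc_poly d \<beta> \<gamma> r (n - 1)
          - (\<Sum>\<nu><d. smult (\<gamma> (nat (n - 1) + r - \<nu>) (d - 1 - \<nu>))
                         (assoc_poly d \<beta> \<gamma> r (n - 2 - int \<nu>))))"
  by pat_completeness auto
termination
  by (relation "measure (\<lambda>(d, \<beta>, \<gamma>, r, n). nat n)") auto

declare assoc_poly.simps [simp del]

lemma assoc_poly_neg: "n < 0 \<Longrightarrow> assoc_poly d \<beta> \<gamma> r n = 0"
  by (subst assoc_poly.simps) simp

lemma assoc_poly_0: "assoc_poly d \<beta> \<gamma> r 0 = 1"
  by (subst assoc_poly.simps) simp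

lemma assoc_poly_rec:
  fixes n :: nat
  shows "assoc_poly d \<beta> \<gamma> r (int n + 1) =
    [:- \<beta> (n + r), 1:] * assoc_poly d \<beta> \<gamma> r (int n)
    - (\<Sum>\<nu><d. smult (\<gamma> (n + r - \<nu>) (d - 1 - \<nu>)) (assoc_poly d \<beta> \<gamma> r (int n - 1 - int \<nu>)))"
  by (subst assoc_poly.simps) (simp add: algebra_simps)

definition monic_d_OPS ::
  "nat \<Rightarrow> (nat \<Rightarrow> complex) \<Rightarrow> (nat \<Rightarrow> nat \<Rightarrow> complex) \<Rightarrow> (int \<Rightarrow> complex poly) \<Rightarrow> bool"
where
  "monic_d_OPS d \<beta> \<gamma> P \<longleftrightarrow>
    (\<forall>n\<ge>1. \<gamma> n 0 \<noteq> 0) \<and> (\<forall>n. P n = assoc_poly d \<beta> \<gamma> 0 n)"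

definition gen_co_recursive ::
  "nat \<Rightarrow> (nat \<Rightarrow> complex) \<Rightarrow> (nat \<Rightarrow> nat \<Rightarrow> complex) \<Rightarrow> (int \<Rightarrow> complex poly) \<Rightarrow> nat
    \<Rightarrow> (nat \<Rightarrow> complex) \<Rightarrow> (nat \<Rightarrow> nat \<Rightarrow> complex) \<Rightarrow> (int \<Rightarrow> complex poly) \<Rightarrow> bool"
where
  "gen_co_recursive d \<beta> \<gamma> P k \<mu> \<eta> Pc \<longleftrightarrow>
    (let \<alpha> = (\<lambda>n. \<beta> n + \<mu> n);
         \<xi> = (\<lambda>n s. if s = 0 then \<gamma> n 0 else \<gamma> n s + \<eta> n s)
     in (\<forall>m<0. Pc m = 0) \<and>
        (\<forall>m::nat. m \<le> k \<longrightarrow> Pc (int m) = P (int m)) \<and>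
        (\<forall>m::nat. k + 1 \<le> m \<and> m \<le> k + d \<longrightarrow>
           Pc (int m) = [:- \<alpha> (m - 1), 1:] * Pc (int m - 1)
             - (\<Sum>\<nu><d. smult (\<xi> (m - 1 - \<nu>) (d - 1 - \<nu>)) (Pc (int m - 2 - int \<nu>)))) \<and>
        (\<forall>m::nat. k \<le> m \<longrightarrow>
           Pc (int (m + d) + 1) = [:- \<beta> (m + d), 1:] * Pc (int (m + d))
             - (\<Sum>\<nu><d. smult (\<gamma> (m + d - \<nu>) (d - 1 - \<nu>)) (Pc (int (m + d) - 1 - int \<nu>)))))"

end

theory Submission
  imports Defs
begin

text \<open>
  The difference \<open>P - P\<^sup>c\<close> vanishes up to index \<open>k\<close> and satisfies the recurrence of \<open>P\<close> up to
  an inhomogeneous term that is nonzero only at the indices \<open>k + 1, \<dots>, k + d\<close>. The sequence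
  \<open>P\<^sup>(\<^sup>r\<^sup>)\<close> shifted by \<open>r\<close> solves the same recurrence with the unit impulse at index \<open>r\<close> as
  inhomogeneous term. Hence, by superposition, the \<open>A\<^sub>i\<close> are the inhomogeneous terms of
  \<open>P - P\<^sup>c\<close>.
\<close>

text \<open>The coefficients are those of order 0. Associated sequences of order \<open>r\<close>
  also fit, because moving the argument by \<open>r\<close> absorbs the shift in their
  coefficients.\<close>

definition recurrence_rhs ::
  "nat \<Rightarrow> (nat \<Rightarrow> complex) \<Rightarrow> (nat \<Rightarrow> nat \<Rightarrow> complex) \<Rightarrow> (int \<Rightarrow> complex poly) \<Rightarrow> nat \<Rightarrow> complex poly"
where
  "recurrence_rhs d \<beta> \<gamma> F N = [:- \<beta> N, 1:] * F (int N)
    - (\<Sum>\<nu><d. smult (\<gamma> (N - \<nu>) (d - 1 - \<nu>)) (F (int N - 1 - int \<nu>)))"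

lemma recurrence_rhs_zero: "recurrence_rhs d \<beta> \<gamma> (\<lambda>_. 0) N = 0"
  by (simp add: recurrence_rhs_def)

lemma recurrence_rhs_add:
  "recurrence_rhs d \<beta> \<gamma> (\<lambda>n. F n + G n) N = recurrence_rhs d \<beta> \<gamma> F N + recurrence_rhs d \<beta> \<gamma> G N"
  unfolding recurrence_rhs_def by (simp only: distrib_left smult_add_right sum.distrib) algebra

lemma recurrence_rhs_diff:
  "recurrence_rhs d \<beta> \<gamma> (\<lambda>n. F n - G n) N = recurrence_rhs d \<beta> \<gamma> F N - recurrence_rhs d \<beta> \<gamma> G N"
  unfolding recurrence_rhs_def
  by (simp only: right_diff_distrib smult_diff_right sum_subtractf) algebra

lemma recurrence_rhs_mult:
  "recurrence_rhs d \<beta> \<gamma> (\<lambda>n. a * F n) N = a * recurrence_rhs d \<beta> \<gamma> F N"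
  unfolding recurrence_rhs_def
  by (simp only: right_diff_distrib sum_distrib_left mult_smult_right mult.left_commute)

lemma recurrence_rhs_sum:
  assumes "finite I"
  shows "recurrence_rhs d \<beta> \<gamma> (\<lambda>n. \<Sum>i\<in>I. F i n) N = (\<Sum>i\<in>I. recurrence_rhs d \<beta> \<gamma> (F i) N)"
  using assms by induction (simp_all add: recurrence_rhs_zero recurrence_rhs_add)

text \<open>\<open>recurrence_rhs\<close> at \<open>N\<close> reads its sequence only at indices up
  to \<open>N\<close>, so equal defects propagate equality from \<open>N\<close> to
  \<open>N + 1\<close>. Negative indices are covered by \<open>init\<close>.\<close>

lemma recurrence_solution_unique:
  assumes init: "\<And>n. n \<le> int k \<Longrightarrow> F n = G n"
    and rec: "\<And>N. k \<le> N \<Longrightarrow> F (int N + 1) - recurrence_rhs d \<beta> \<gamma> F N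
                            = G (int N + 1) - recurrence_rhs d \<beta> \<gamma> G N"
  shows "F n = G n"
proof (induction "nat n" arbitrary: n rule: less_induct)
  case less
  show ?case
  proof (cases "n \<le> int k")
    case False
    define N where "N = nat (n - 1)"
    have n: "n = int N + 1" and "k \<le> N"
      using False by (auto simp: N_def)
    have "F m = G m" if "m \<le> int N" for m
      using that less init n by (cases "m < 0") auto
    then have "recurrence_rhs d \<beta> \<gamma> F N = recurrence_rhs d \<beta> \<gamma> G N"
      by (simp add: recurrence_rhs_def)
    with rec[OF \<open>k \<le> N\<close>] show ?thesis
      by (simp add: n)
  qed (rule init)
qed

text \<open>For \<open>r \<le> N\<close> this is the recurrence of order \<open>r\<close> after
  substituting \<open>N = m + r\<close>. For \<open>N < r\<close> every polynomial in
  \<open>recurrence_rhs\<close> has negative index, and the initial value 1 at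
  \<open>N + 1 = r\<close> becomes the impulse.\<close>

lemma assoc_poly_shift_rec:
  "assoc_poly d \<beta> \<gamma> r (int N + 1 - int r) =
    recurrence_rhs d \<beta> \<gamma> (\<lambda>n. assoc_poly d \<beta> \<gamma> r (n - int r)) N + (if N + 1 = r then 1 else 0)"
proof (cases "r \<le> N")
  case True
  then obtain m where N: "N = m + r"
    by (metis le_add_diff_inverse2)
  have "int (m + r) + 1 - int r = int m + 1" "int (m + r) - int r = int m"
    "int (m + r) - 1 - int \<nu> - int r = int m - 1 - int \<nu>" for \<nu>
    by simp_all
  then show ?thesis
    by (simp only: N recurrence_rhs_def assoc_poly_rec) simp
next
  case False
  then have "recurrence_rhs d \<beta> \<gamma> (\<lambda>n. assoc_poly d \<beta> \<gamma> r (n - int r)) N = 0"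
    by (simp add: recurrence_rhs_def assoc_poly_neg)
  moreover have "assoc_poly d \<beta> \<gamma> r (int N + 1 - int r) = (if N + 1 = r then 1 else 0)"
    using False by (auto simp: assoc_poly_0 assoc_poly_neg)
  ultimately show ?thesis
    by simp
qed

text \<open>The factors \<open>A i\<close> do not depend on the index, so linearity leaves a sum of
  impulses weighted by \<open>A i\<close>. Only the one with \<open>k + i = N + 1\<close> can be
  nonzero.\<close>

lemma assoc_poly_superposition_rec:
  "(\<Sum>i=1..d. A i * assoc_poly d \<beta> \<gamma> (k + i) (int N + 1 - int (k + i)))
    - recurrence_rhs d \<beta> \<gamma> (\<lambda>n. \<Sum>i=1..d. A i * assoc_poly d \<beta> \<gamma> (k + i) (n - int (k + i))) N
    = (if N + 1 \<in> {k + 1..k + d} then A (N + 1 - k) else 0)"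
proof -
  have "(\<Sum>i=1..d. A i * (if N + 1 = k + i then 1 else 0))
      = (\<Sum>i=1..d. if i = N + 1 - k \<and> k \<le> N then A i else 0)"
    by (rule sum.cong) auto
  also have "\<dots> = (if N + 1 \<in> {k + 1..k + d} then A (N + 1 - k) else 0)"
    by (cases "k \<le> N") auto
  finally show ?thesis
    by (simp add: recurrence_rhs_sum recurrence_rhs_mult assoc_poly_shift_rec distrib_left
        sum.distrib del: of_nat_add)
qed

theorem proposition3p2:
  fixes d k :: nat
    and \<beta> \<mu> :: "nat \<Rightarrow> complex"
    and \<gamma> \<eta> :: "nat \<Rightarrow> nat \<Rightarrow> complex"
    and P Pc :: "int \<Rightarrow> complex poly"
  assumes "d \<ge> 1"
    and "monic_d_OPS d \<beta> \<gamma> P"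
    and "gen_co_recursive d \<beta> \<gamma> P k \<mu> \<eta> Pc"
  shows "\<exists>A :: nat \<Rightarrow> complex poly.
    (\<forall>n\<ge>0. Pc n = P n - (\<Sum>i=1..d. A i * assoc_poly d \<beta> \<gamma> (k + i) (n - int k - int i))) \<and>
    (\<forall>n\<le>int k. Pc n = P n)"
proof -
  define D where "D n = P n - Pc n" for n
  \<comment> \<open>\<open>A i\<close> is the defect of \<open>D\<close> at index
    \<open>k + i\<close>, hence the evaluation of the right-hand side at \<open>k + i - 1\<close>.
    Only \<open>i \<ge> 1\<close> matters, where the subtraction does not truncate.\<close>
  define A where "A i = D (int (k + i)) - recurrence_rhs d \<beta> \<gamma> D (k + i - 1)" for i
  define S where "S n = (\<Sum>i=1..d. A i * assoc_poly d \<beta> \<gamma> (k + i) (n - int (k + i)))" for n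
  have P: "P n = assoc_poly d \<beta> \<gamma> 0 n" for n
    using assms(2) by (simp add: monic_d_OPS_def)
  have Pc_neg: "Pc n = 0" if "n < 0" for n
    using assms(3) that by (simp add: gen_co_recursive_def Let_def)
  have Pc_init: "Pc (int m) = P (int m)" if "m \<le> k" for m
    using assms(3) that by (simp add: gen_co_recursive_def Let_def)
  have Pc_rec: "Pc (int N + 1) = recurrence_rhs d \<beta> \<gamma> Pc N" if "k + d \<le> N" for N
  proof -
    have "k \<le> N - d" "N - d + d = N"
      using that by simp_all
    moreover have "Pc (int (m + d) + 1) = recurrence_rhs d \<beta> \<gamma> Pc (m + d)" if "k \<le> m" for m
      using assms(3) that by (simp only: gen_co_recursive_def Let_def recurrence_rhs_def)
    ultimately show ?thesis
      by metis
  qed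
  have init: "Pc n = P n" if "n \<le> int k" for n
  proof (cases "n < 0")
    case True
    then show ?thesis
      by (simp add: Pc_neg P assoc_poly_neg)
  next
    case False
    then show ?thesis
      using Pc_init[of "nat n"] that by simp
  qed
  \<comment> \<open>For \<open>r = 0\<close> the impulse would sit at \<open>N + 1 = 0\<close>,
    which never occurs.\<close>
  have P_rec: "P (int N + 1) = recurrence_rhs d \<beta> \<gamma> P N" for N
    using assoc_poly_shift_rec[of d \<beta> \<gamma> 0 N] by (simp add: recurrence_rhs_def P)
  have "D n = S n" for n
  proof (rule recurrence_solution_unique)
    \<comment> \<open>Both sides vanish: \<open>D\<close> by the initial values, \<open>S\<close>
      because \<open>n - (k + i)\<close> is negative for \<open>i \<ge> 1\<close>.\<close>
    show "D n = S n" if "n \<le> int k" for n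
      using that by (simp add: D_def S_def init assoc_poly_neg)
    show "D (int N + 1) - recurrence_rhs d \<beta> \<gamma> D N = S (int N + 1) - recurrence_rhs d \<beta> \<gamma> S N"
      if "k \<le> N" for N
    proof -
      have "D (int N + 1) - recurrence_rhs d \<beta> \<gamma> D N
          = (if N + 1 \<in> {k + 1..k + d} then A (N + 1 - k) else 0)"
      \<comment> \<open>Below \<open>k + d\<close> the equation is the definition of
        \<open>A\<close> at \<open>N + 1 - k\<close>. From \<open>k + d\<close> on, \<open>P\<close>
        and \<open>Pc\<close> obey the same recurrence, so the defect of their difference is
        zero.\<close>
      proof (cases "N < k + d")
        case True
        with that show ?thesis
          by (simp add: A_def add.commute)
      next
        case False
        then show ?thesis
          by (simp add: D_def[abs_def] recurrence_rhs_diff P_rec Pc_rec)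
      qed
      then show ?thesis
        unfolding S_def[abs_def] assoc_poly_superposition_rec .
    qed
  qed
  then have "Pc n = P n - S n" for n
    by (simp add: D_def flip: \<open>\<And>n. D n = S n\<close>)
  with init show ?thesis
    by (intro exI[of _ A]) (auto simp: S_def diff_diff_eq)
qed

end
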